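(* Consider the following nondeterministic program on states $(w,x,y,z)\in\mathbb{Z}^4$. Initially $(w,x,y,z)$ is an arbitrary element of $\mathbb{Z}^4$ supplied by the user. While $w>0$ and $x>0$ and $y>0$ and $z>0$, the user chooses a value $\mathrm{control}\in\{1,2,3\}$ and the following is executed: \begin{itemize} \item if $\mathrm{control}=1$: $x$ is replaced by a value chosen by the user from $\{x+1,x+2,\ldots\}$, $w$ is replaced by $w-1$, and $y,z$ are unchanged; \item if $\mathrm{control}=2$: $y$ is replaced by a value chosen by the user from $\{y+1,y+2,\ldots\}$, $x$ is replaced by $x-1$, and $w,z$ are unchanged; \item if $\mathrm{control}=3$: $z$ is replaced by a value chosen by the user from $\{z+1,z+2,\ldots\}$, $y$ is replaced by $y-1$, and $w,x$ are unchanged. \end{itemize} Then every computation of this program is finite.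
   Context: A program is a tuple $(S,I,R)$ where $S$ is a set of states, $I\subseteq S$ is the set of possible initial states, and $R\subseteq S\times S$ is the set of pairs $(s,t)$ such that $s$ satisfies the condition of the while loop and some choice of instruction (and of user inputs) takes $s$ to $t$ in one iteration of the loop body. A computation is a finite or infinite sequence of states $s_1,s_2,\ldots$ with $s_1\in I$, with $R(s_i,s_{i+1})$ for all consecutive terms, and such that if the sequence is finite with last state $s$ then there is no $t$ with $R(s,t)$. Here $S=I=\mathbb{Z}^4$. *)

theory Defs
  imports Main
begin

record 'a program =
  states :: "'a set"
  initial :: "'a set"
  transition :: "('a \<times> 'a) set"

definition wf_program :: "'a program \<Rightarrow> bool" where
  "wf_program P \<longleftrightarrow>
     initial P \<subseteq> states P \<and> transition P \<subseteq> states P \<times> states P"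

text \<open>A finite or infinite sequence; the term \<open>s\<^sub>i\<close> of the mathematical notation
  is stored at index \<open>i - 1\<close>.\<close>

datatype 'a sequence = Finite_Seq "'a list" | Infinite_Seq "nat \<Rightarrow> 'a"

fun finite_seq :: "'a sequence \<Rightarrow> bool" where
  "finite_seq (Finite_Seq ss) \<longleftrightarrow> True"
| "finite_seq (Infinite_Seq s) \<longleftrightarrow> False"

fun computation :: "'a program \<Rightarrow> 'a sequence \<Rightarrow> bool" where
  "computation P (Finite_Seq ss) \<longleftrightarrow>
     ss \<noteq> [] \<and> set ss \<subseteq> states P \<and> hd ss \<in> initial P \<and>
     (\<forall>i. Suc i < length ss \<longrightarrow> (ss ! i, ss ! Suc i) \<in> transition P) \<and>
     \<not> (\<exists>t. (last ss, t) \<in> transition P)"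
| "computation P (Infinite_Seq s) \<longleftrightarrow>
     range s \<subseteq> states P \<and> s 0 \<in> initial P \<and>
     (\<forall>i. (s i, s (Suc i)) \<in> transition P)"

type_synonym state = "int \<times> int \<times> int \<times> int"

fun loop_cond :: "state \<Rightarrow> bool" where
  "loop_cond (w, x, y, z) \<longleftrightarrow> w > 0 \<and> x > 0 \<and> y > 0 \<and> z > 0"

text \<open>The possible results of one execution of the loop body for a given value of
  \<open>control\<close>, over all choices of the new value by the user.\<close>

fun loop_body :: "nat \<Rightarrow> state \<Rightarrow> state set" where
  "loop_body control (w, x, y, z) =
     (if control = 1 then {(w - 1, x', y, z) | x'. x' \<in> {x + 1..}}
      else if control = 2 then {(w, x - 1, y', z) | y'. y' \<in> {y + 1..}}
      else if control = 3 then {(w, x, y - 1, z') | z'. z' \<in> {z + 1..}}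
      else {})"

definition control_program :: "state program" where
  "control_program =
     \<lparr>states = UNIV, initial = UNIV,
      transition = {(s, t). loop_cond s \<and> (\<exists>control\<in>{1, 2, 3}. t \<in> loop_body control s)}\<rparr>"

lemma wf_control_program: "wf_program control_program"
  by (simp add: wf_program_def control_program_def)

end

theory Submission
  imports Defs
begin

text \<open>Each control value decreases one of \<open>w\<close>, \<open>x\<close>, \<open>y\<close>, which the loop condition keeps
  positive, and leaves the earlier ones unchanged. Hence \<open>(w, x, y)\<close> decreases
  lexicographically in \<open>\<nat>\<^sup>3\<close>, however large the user's choices are.\<close>

lemma wf_converse_transition_control_program:
  "wf ((transition control_program)\<inverse>)"
proof (rule wf_subset)
  \<comment> \<open>\<open>nat\<close> sends every nonpositive integer to 0, yet the decrease stays
    strict: the loop condition makes the component positive before 1 is subtracted from it.\<close>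
  let ?rank = "\<lambda>(w, x, y, z). (nat w, nat x, nat y)"
  show "wf (inv_image (less_than <*lex*> less_than <*lex*> less_than) ?rank)"
    by (intro wf_inv_image wf_lex_prod wf_less_than)
  show "(transition control_program)\<inverse>
      \<subseteq> inv_image (less_than <*lex*> less_than <*lex*> less_than) ?rank"
    by (auto simp: control_program_def)
qed

theorem theorem4p4:
  shows "\<forall>c. computation control_program c \<longrightarrow> finite_seq c"
proof (intro allI impI)
  fix c
  assume c: "computation control_program c"
  show "finite_seq c"
  proof (cases c)
    case (Infinite_Seq s)
    \<comment> \<open>Under the converse relation each successor lies below its predecessor, so an
      infinite computation is an infinite descending chain, which contradicts
      well-foundedness.\<close>
    with c have "\<forall>i. (s (Suc i), s i) \<in> (transition control_program)\<inverse>"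
      by simp
    with wf_converse_transition_control_program show ?thesis
      unfolding wf_iff_no_infinite_down_chain by blast
  qed simp
qed

end
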